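(* Let $p$ be a prime number and $m$ a positive integer. If $A$ is a tile in $\mathbb Z_{p^m}\times\mathbb Z_{p^m}$ with $|A|=p^{2m-1}$, then $A$ is spectral in $\mathbb Z_{p^m}\times\mathbb Z_{p^m}$.
   Context: $\mathbb Z_n$ denotes the additive cyclic group of order $n$. A subset $A$ of a finite abelian group $G$ is a tile in $G$ if there is $B\subseteq G$ such that every element of $G$ can be written in exactly one way as $a+b$ with $a\in A$, $b\in B$. For $x=(x_1,x_2)$, $s=(s_1,s_2)$ in $\mathbb Z_n\times\mathbb Z_n$ put $\langle x,s\rangle=x_1s_1+x_2s_2$ (mod $n$). A subset $A\subseteq\mathbb Z_n\times\mathbb Z_n$ is spectral if there is $S\subseteq\mathbb Z_n\times\mathbb Z_n$ such that the family of functions $x\mapsto e^{2\pi i\langle x,s\rangle/n}$ on $A$, indexed by $s\in S$, is an orthogonal basis of $L^2(A)$ with respect to the counting measure on $A$. *)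

theory Defs
  imports
    Complex_Main
    "HOL-Computational_Algebra.Primes"
    "HOL-Algebra.Elementary_Groups"
begin

definition tile :: "('a, 'b) monoid_scheme \<Rightarrow> 'a set \<Rightarrow> bool" where
  "tile G A \<longleftrightarrow>
     A \<subseteq> carrier G \<and>
     (\<exists>B. B \<subseteq> carrier G \<and>
        (\<forall>g\<in>carrier G. \<exists>!ab. ab \<in> A \<times> B \<and> g = fst ab \<otimes>\<^bsub>G\<^esub> snd ab))"

abbreviation ZnZn :: "nat \<Rightarrow> (int \<times> int) monoid" where
  "ZnZn n \<equiv> integer_mod_group n \<times>\<times> integer_mod_group n"

definition pairing :: "nat \<Rightarrow> int \<times> int \<Rightarrow> int \<times> int \<Rightarrow> int" where
  "pairing n x s = (fst x * fst s + snd x * snd s) mod int n"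

definition character :: "nat \<Rightarrow> int \<times> int \<Rightarrow> int \<times> int \<Rightarrow> complex" where
  "character n s x = exp (2 * complex_of_real pi * \<i> * of_int (pairing n x s) / of_nat n)"

(* For a finite set A, the space L^2(A) with respect to counting measure consists of all
   complex functions on A.  They are represented by functions on the whole type, of which only
   the values on A are ever used. *)
definition L2_inner :: "'a set \<Rightarrow> ('a \<Rightarrow> complex) \<Rightarrow> ('a \<Rightarrow> complex) \<Rightarrow> complex" where
  "L2_inner A f g = (\<Sum>x\<in>A. f x * cnj (g x))"

(* A basis of the finite-dimensional space L^2(A) is finite, so finite linear combinations
   suffice.  The family is indexed: in a basis, distinct indices give distinct functions on A. *)
definition L2_basis :: "'a set \<Rightarrow> 'i set \<Rightarrow> ('i \<Rightarrow> 'a \<Rightarrow> complex) \<Rightarrow> bool" where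
  "L2_basis A S e \<longleftrightarrow>
     finite S \<and>
     (\<forall>c. (\<forall>x\<in>A. (\<Sum>s\<in>S. c s * e s x) = 0) \<longrightarrow> (\<forall>s\<in>S. c s = 0)) \<and>
     (\<forall>f. \<exists>c. \<forall>x\<in>A. f x = (\<Sum>s\<in>S. c s * e s x))"

definition L2_orthogonal_basis :: "'a set \<Rightarrow> 'i set \<Rightarrow> ('i \<Rightarrow> 'a \<Rightarrow> complex) \<Rightarrow> bool" where
  "L2_orthogonal_basis A S e \<longleftrightarrow>
     L2_basis A S e \<and>
     (\<forall>s\<in>S. \<forall>t\<in>S. s \<noteq> t \<longrightarrow> L2_inner A (e s) (e t) = 0)"

definition spectral :: "nat \<Rightarrow> (int \<times> int) set \<Rightarrow> bool" where
  "spectral n A \<longleftrightarrow>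
     A \<subseteq> carrier (ZnZn n) \<and>
     (\<exists>S. S \<subseteq> carrier (ZnZn n) \<and> L2_orthogonal_basis A S (character n))"

end

theory Submission
  imports
    Defs
    "HOL-Computational_Algebra.Polynomial_Factorial"
    "HOL-Library.Product_Plus"
    "HOL-Number_Theory.Cong"
begin

text \<open>Write \<open>n = p ^ m\<close> and let \<open>B\<close> be a tiling complement of \<open>A\<close>, so \<open>|B| = p\<close> and the product of
  the Fourier transforms of \<open>A\<close> and \<open>B\<close> vanishes off 0. Since the cyclotomic polynomial of order
  \<open>p ^ m\<close> is irreducible, the transform of \<open>B\<close> vanishes at \<open>s\<close> only if the values \<open>\<langle>b, s\<rangle>\<close> form
  exactly one coset of \<open>(n/p)\<int>\<close>. Hence all such zeros \<open>s\<close> lie in the subgroup \<open>T\<close> of those \<open>s\<close>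
  that are constant on \<open>B\<close> modulo \<open>n/p\<close>, and for fixed distinct \<open>b1, b2\<close> in \<open>B\<close> none of them lies in
  the index-\<open>p\<close> subgroup \<open>L\<close> of \<open>T\<close> orthogonal to \<open>d = b1 - b2\<close>. If \<open>R\<close> is a transversal of \<open>T\<close>, then
  the differences of \<open>S = R + L\<close> therefore avoid the zeros of the transform of \<open>B\<close>, so the
  characters from \<open>S\<close> are orthogonal on \<open>A\<close>; and \<open>S\<close> has \<open>n\<^sup>2 / p = |A|\<close> elements.\<close>

section \<open>Integer polynomials with a common root\<close>

text \<open>By absorption, \<open>i * (p ^ k choose i)\<close> is a multiple of
  \<open>p ^ k\<close>. If the binomial coefficient were prime to \<open>p\<close>, then
  \<open>p ^ k\<close> would divide \<open>i\<close>, which is positive and smaller.\<close>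

lemma prime_dvd_choose_prime_power:
  assumes "prime p" "0 < i" "i < p ^ k"
  shows "p dvd (p ^ k choose i)"
proof (rule ccontr)
  assume "\<not> p dvd (p ^ k choose i)"
  then have cop: "coprime (p ^ k) (p ^ k choose i)"
    using assms(1) by (simp add: prime_imp_coprime)
  have "i * (p ^ k choose i) = p ^ k * (p ^ k - 1 choose (i - 1))"
    using assms(2,3) times_binomial_minus1_eq by blast
  then have "p ^ k dvd i"
    using cop by (metis coprime_dvd_mult_left_iff dvd_triv_left)
  then show False
    using assms(2,3) by (auto dest: dvd_imp_le)
qed

text \<open>Eisenstein's criterion. In a factorization one factor \<open>h\<close> has constant term
  prime to \<open>p\<close>. The lowest coefficient prime to \<open>p\<close> of the other factor
  \<open>g\<close> makes the coefficient of \<open>f\<close> at the same index prime to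
  \<open>p\<close>, so this index is already \<open>degree f\<close>. Hence \<open>h\<close> is
  constant, and a unit because \<open>f\<close> is monic.\<close>

lemma eisenstein_int:
  fixes f :: "int poly" and p :: int
  assumes p: "prime p" and monic: "lead_coeff f = 1" and deg: "degree f > 0"
    and dvd: "\<And>i. i < degree f \<Longrightarrow> p dvd coeff f i" and not_sq: "\<not> p ^ 2 dvd coeff f 0"
  shows "irreducible f"
proof (rule irreducibleI)
  show "f \<noteq> 0" "\<not> f dvd 1"
    using deg by (auto simp: is_unit_poly_iff)
next
  have main: "h dvd 1" if fgh: "f = g * h" and h0: "\<not> p dvd coeff h 0" for g h
  proof -
    have lead: "lead_coeff g * lead_coeff h = 1"
      using fgh monic by (simp add: lead_coeff_mult)
    have [simp]: "g \<noteq> 0" "h \<noteq> 0" using fgh deg by auto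
    define k where "k = (LEAST k. \<not> p dvd coeff g k)"
    have "\<not> p dvd lead_coeff g"
      using lead p by (metis dvd_mult2 not_prime_unit)
    then have k: "\<not> p dvd coeff g k" and k_le: "k \<le> degree g"
      unfolding k_def by (rule LeastI, rule Least_le)
    have less: "p dvd coeff g i" if "i < k" for i
      using not_less_Least that unfolding k_def by blast
    have "coeff f k = (\<Sum>i\<le>k. coeff g i * coeff h (k - i))"
      by (simp add: fgh coeff_mult)
    also have "\<dots> = (\<Sum>i<k. coeff g i * coeff h (k - i)) + coeff g k * coeff h 0"
      by (simp add: lessThan_Suc_atMost[symmetric])
    finally have "\<not> p dvd coeff f k"
      using k h0 p less dvd_sum[of "{..<k}" p "\<lambda>i. coeff g i * coeff h (k - i)"]
      by (simp add: dvd_add_right_iff prime_dvd_mult_iff)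
    then have "degree f \<le> k" using dvd by (meson not_le)
    moreover have "degree f = degree g + degree h"
      by (simp add: fgh degree_mult_eq)
    ultimately have "degree h = 0" using k_le by simp
    then obtain c where h: "h = [:c:]" by (rule degree_eq_zeroE)
    then have "c dvd 1" using lead by (metis dvd_triv_right lead_coeff_pCons(2))
    then show ?thesis by (simp add: h is_unit_const_poly_iff)
  qed
  fix g h assume fgh: "f = g * h"
  have "coeff f 0 = coeff g 0 * coeff h 0" by (simp add: fgh coeff_mult)
  then have "\<not> p dvd coeff g 0 \<or> \<not> p dvd coeff h 0"
    using not_sq by (auto simp: power2_eq_square intro: mult_dvd_mono)
  then show "g dvd 1 \<or> h dvd 1"
    using main[of g h] main[of h g] fgh by (auto simp: mult.commute)
qed

section \<open>Evaluation of integer polynomials at complex numbers\<close>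

definition ipoly :: "int poly \<Rightarrow> complex \<Rightarrow> complex" where
  "ipoly f z = poly (map_poly of_int f) z"

lemma ipoly_0 [simp]: "ipoly 0 z = 0"
  by (simp add: ipoly_def)

lemma ipoly_pCons [simp]: "ipoly (pCons a f) z = of_int a + z * ipoly f z"
  by (simp add: ipoly_def map_poly_pCons)

lemma ipoly_add [simp]: "ipoly (f + g) z = ipoly f z + ipoly g z"
  by (induction f g rule: poly_induct2) (simp_all add: algebra_simps)

lemma ipoly_1 [simp]: "ipoly 1 z = 1"
  by (simp add: ipoly_def)

lemma ipoly_smult [simp]: "ipoly (smult c f) z = of_int c * ipoly f z"
  by (induction f) (simp_all add: algebra_simps)

lemma ipoly_diff [simp]: "ipoly (f - g) z = ipoly f z - ipoly g z"
  using ipoly_add[of "f - g" g z] by simp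

lemma ipoly_mult [simp]: "ipoly (f * g) z = ipoly f z * ipoly g z"
  by (induction f) (simp_all add: algebra_simps)

lemma ipoly_pcompose: "ipoly (pcompose f g) z = ipoly f (ipoly g z)"
  by (induction f) (simp_all add: pcompose_pCons)

lemma ipoly_monom [simp]: "ipoly (monom c k) z = of_int c * z ^ k"
  by (simp add: ipoly_def map_poly_monom poly_monom)

lemma ipoly_sum [simp]: "ipoly (\<Sum>i\<in>I. f i) z = (\<Sum>i\<in>I. ipoly (f i) z)"
  by (induction I rule: infinite_finite_induct) simp_all

text \<open>Pseudo-division by an annihilating polynomial of least degree makes every annihilating
  polynomial a rational multiple of it; primality of \<open>f\<close> removes the denominators.\<close>

lemma irreducible_dvd_common_root:
  fixes f g :: "int poly" and z :: complex
  assumes irr: "irreducible f" and deg: "degree f > 0"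
    and f: "ipoly f z = 0" and g: "ipoly g z = 0"
  shows "f dvd g"
proof -
  define ann where "ann = (\<lambda>q :: int poly. q \<noteq> 0 \<and> ipoly q z = 0)"
  define q where "q = arg_min degree ann"
  have "ann f" using irr f by (auto simp: ann_def)
  then have "ann q" and min: "\<And>r. ann r \<Longrightarrow> degree q \<le> degree r"
    unfolding q_def by (auto intro: arg_min_natI arg_min_nat_le)
  have q: "q \<noteq> 0" "ipoly q z = 0" using \<open>ann q\<close> by (auto simp: ann_def)
  have deg_q: "degree q > 0"
  proof (rule ccontr)
    assume "\<not> degree q > 0"
    then obtain c where "q = [:c:]" using degree_eq_zeroE by blast
    then show False using q by simp
  qed
  have prime: "prime_elem f" by (rule irreducible_imp_prime_poly[OF irr])
  have multiple: "\<exists>c r. c \<noteq> 0 \<and> smult c h = q * r"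
    if h: "ipoly h z = 0" for h
  proof -
    obtain c r where c: "c \<noteq> 0" "smult c h = q * r + pseudo_mod h q"
      and small: "pseudo_mod h q = 0 \<or> degree (pseudo_mod h q) < degree q"
      using pseudo_mod[OF q(1), of h] by blast
    have "of_int c * ipoly h z =
        ipoly q z * ipoly r z
        + ipoly (pseudo_mod h q) z"
      using arg_cong[OF c(2), of "\<lambda>q. ipoly q z"] by simp
    then have "ipoly (pseudo_mod h q) z = 0"
      using h q by simp
    then have "pseudo_mod h q = 0" using small min by (fastforce simp: ann_def)
    then show ?thesis using c by auto
  qed
  obtain c r where cr: "c \<noteq> 0" "smult c f = q * r" using multiple[OF f] by blast
  \<comment> \<open>\<open>f\<close> is prime and divides \<open>q * r\<close>. Were it to divide
    \<open>r\<close>, comparing degrees in \<open>smult c f = q * r\<close> would make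
    \<open>q\<close> constant.\<close>
  have "f dvd q"
  proof (rule ccontr)
    assume "\<not> f dvd q"
    moreover have "f dvd q * r" using cr by (metis dvd_refl dvd_smult)
    ultimately have "f dvd r" using prime prime_elem_dvd_mult_iff by blast
    moreover have "r \<noteq> 0" using cr irr by auto
    ultimately have "degree f \<le> degree r" by (rule dvd_imp_degree_le)
    moreover have "degree f = degree q + degree r"
      using cr q(1) \<open>r \<noteq> 0\<close> by (metis degree_mult_eq degree_smult_eq)
    ultimately show False using deg_q by simp
  qed
  obtain c' r' where cr': "c' \<noteq> 0" "smult c' g = q * r'" using multiple[OF g] by blast
  have "f dvd [:c':] * g" using \<open>f dvd q\<close> cr' by simp
  moreover have "\<not> f dvd [:c':]"
    using deg cr'(1) dvd_imp_degree_le[of f "[:c':]"] by auto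
  ultimately show ?thesis using prime prime_elem_dvd_mult_iff by blast
qed

section \<open>Cyclotomic polynomials of prime power order\<close>

text \<open>Frobenius modulo \<open>p\<close>: the inner binomial coefficients are multiples of
  \<open>p\<close>. Collecting them in \<open>u\<close> turns the congruence into an equation over
  the integers.\<close>

lemma linear_power_prime_power_mod:
  assumes "prime p"
  obtains u :: "int poly"
  where "[:1, 1:] ^ (p ^ k) = 1 + monom 1 (p ^ k) + smult (int p) u"
proof -
  let ?d = "[:1, 1:] ^ (p ^ k) - 1 - monom 1 (p ^ k) :: int poly"
  have pos: "p ^ k > 0" using assms prime_gt_0_nat by simp
  have "int p dvd coeff ?d i" for i
  proof -
    consider "i = 0" | "0 < i" "i < p ^ k" | "i = p ^ k" | "i > p ^ k" by linarith
    then show ?thesis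
    proof cases
      case 2
      then have "int p dvd int (p ^ k choose i)"
        using prime_dvd_choose_prime_power[OF assms] of_nat_dvd_iff by blast
      then show ?thesis using 2 by (simp add: coeff_linear_poly_power)
    next
      case 4
      then have "coeff ([:1, 1:] ^ (p ^ k) :: int poly) i = 0"
        by (intro coeff_eq_0) (simp add: degree_linear_power)
      then show ?thesis using 4 pos by simp
    qed (use pos in \<open>auto simp: coeff_linear_poly_power\<close>)
  qed
  then have "[:int p:] dvd ?d" by (simp add: const_poly_dvd_iff)
  then obtain u where "?d = [:int p:] * u" by (rule dvdE)
  then have "[:1, 1:] ^ (p ^ k) = 1 + monom 1 (p ^ k) + smult (int p) u"
    by (simp add: algebra_simps)
  then show thesis by (rule that)
qed

lemma pcompose_monom: "pcompose (monom c n) q = smult c (q ^ n)"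
  by (induction n) (simp_all add: monom_0 monom_Suc pcompose_pCons)

text \<open>For prime \<open>p\<close> and \<open>N = p ^ k\<close> this is the cyclotomic
  polynomial of order \<open>p ^ Suc k\<close>, the quotient of x^(pN) - 1 by x^N - 1.\<close>

definition prime_power_cyclotomic :: "nat \<Rightarrow> nat \<Rightarrow> int poly" where
  "prime_power_cyclotomic p N = (\<Sum>i<p. monom 1 (i * N))"

lemma prime_power_cyclotomic_mult:
  "prime_power_cyclotomic p N * (monom 1 N - 1) = monom 1 (p * N) - 1"
  unfolding prime_power_cyclotomic_def
  by (induction p) (simp_all add: algebra_simps mult_monom)

lemma degree_prime_power_cyclotomic:
  assumes "p > 0" "N > 0"
  shows "degree (prime_power_cyclotomic p N) = (p - 1) * N"
    and "lead_coeff (prime_power_cyclotomic p N) = 1"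
proof -
  have c: "coeff (prime_power_cyclotomic p N) j = (\<Sum>i<p. if i * N = j then 1 else 0)" for j
    by (simp add: prime_power_cyclotomic_def coeff_sum)
  have top: "coeff (prime_power_cyclotomic p N) ((p - 1) * N) = 1"
    using assms by (simp add: c)
  have "coeff (prime_power_cyclotomic p N) j = 0" if "j > (p - 1) * N" for j
  proof -
    have "i * N \<noteq> j" if "i < p" for i
      using that \<open>j > (p - 1) * N\<close> mult_le_mono1[of i "p - 1" N] by linarith
    then show ?thesis by (simp add: c)
  qed
  then show "degree (prime_power_cyclotomic p N) = (p - 1) * N"
    using top by (intro antisym degree_le le_degree) auto
  with top show "lead_coeff (prime_power_cyclotomic p N) = 1" by simp
qed

text \<open>Eisenstein's criterion applies after the substitution \<open>x = y + 1\<close>.\<close>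

lemma irreducible_shifted_cyclotomic:
  assumes p: "prime p"
  shows "irreducible (pcompose (prime_power_cyclotomic p (p ^ k)) [:1, 1:])"
proof -
  define N where "N = p ^ k"
  define f where "f = pcompose (prime_power_cyclotomic p N) [:1, 1:]"
  have N: "N > 0" and p1: "p > 1"
    using p prime_gt_0_nat prime_gt_1_nat[OF p] by (simp_all add: N_def)
  have deg: "degree f = (p - 1) * N"
    using degree_prime_power_cyclotomic[of p N] p1 N by (simp add: f_def degree_pcompose)
  have lead: "lead_coeff f = 1"
    unfolding f_def using p1 N
    by (subst lead_coeff_comp) (simp_all del: One_nat_def add: degree_prime_power_cyclotomic(2))
  obtain u where u: "[:1, 1:] ^ N = 1 + monom 1 N + smult (int p) u"
    unfolding N_def by (rule linear_power_prime_power_mod[OF p])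
  obtain v where v: "[:1, 1:] ^ (p * N) = 1 + monom 1 (p * N) + smult (int p) v"
    using linear_power_prime_power_mod[OF p, of "Suc k"] by (auto simp: N_def)
  have "f * ([:1, 1:] ^ N - 1) = [:1, 1:] ^ (p * N) - 1"
    using arg_cong[OF prime_power_cyclotomic_mult[of p N], of "\<lambda>q. pcompose q [:1, 1:]"]
    by (simp add: f_def pcompose_mult pcompose_diff pcompose_1 pcompose_monom)
  \<comment> \<open>Modulo \<open>p\<close> this says that \<open>f\<close> times y^N is y^(pN).
    Comparing coefficients at \<open>i + N\<close> with \<open>i\<close> below
    \<open>degree f\<close>, which is (p - 1)N, shows that \<open>p\<close> divides
    \<open>coeff f i\<close>.\<close>
  then have eq: "f * monom 1 N + smult (int p) (f * u) = monom 1 (p * N) + smult (int p) v"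
    unfolding u v by (simp add: algebra_simps)
  have "int p dvd coeff f i" if "i < degree f" for i
  proof -
    have "i + N \<noteq> p * N"
      using that deg p1 by (auto simp: diff_mult_distrib)
    then have "coeff f i + int p * coeff (f * u) (i + N) = int p * coeff v (i + N)"
      using arg_cong[OF eq, of "\<lambda>q. coeff q (i + N)"] coeff_monom_mult[of 1 N f "i + N"]
      by (simp add: mult.commute)
    then have "coeff f i = int p * (coeff v (i + N) - coeff (f * u) (i + N))"
      by (simp add: algebra_simps)
    then show ?thesis by simp
  qed
  \<comment> \<open>The constant term after the shift is the value of the cyclotomic polynomial at
    1, a sum of \<open>p\<close> ones.\<close>
  moreover have "coeff f 0 = int p"
    by (simp add: f_def prime_power_cyclotomic_def poly_0_coeff_0[symmetric] poly_pcompose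
        poly_sum poly_monom)
  then have "\<not> int p ^ 2 dvd coeff f 0"
    using p1 by (simp add: power2_eq_square)
  moreover have "degree f > 0" using deg p1 N by simp
  ultimately show ?thesis
    using eisenstein_int[of "int p" f] lead p by (simp add: f_def N_def)
qed

text \<open>The hypotheses make \<open>z\<close> a root of unity of exact order
  \<open>p * p ^ k\<close>, hence a root of the cyclotomic polynomial. Irreducibility is known for
  the shifted polynomial, so divisibility is proved at the common root \<open>z - 1\<close> and then
  shifted back.\<close>

lemma prime_power_cyclotomic_dvd:
  assumes p: "prime p" and z: "z ^ (p * p ^ k) = 1" "z ^ (p ^ k) \<noteq> 1"
    and f: "ipoly f z = 0"
  shows "prime_power_cyclotomic p (p ^ k) dvd f"
proof -
  let ?c = "prime_power_cyclotomic p (p ^ k)"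
  have "ipoly ?c z * (z ^ (p ^ k) - 1) = z ^ (p * p ^ k) - 1"
    using arg_cong[OF prime_power_cyclotomic_mult[of p "p ^ k"], of "\<lambda>q. ipoly q z"] by simp
  then have "ipoly ?c z = 0" using z by simp
  moreover have "degree (pcompose ?c [:1, 1:]) > 0"
    using prime_gt_1_nat[OF p] by (simp add: degree_pcompose degree_prime_power_cyclotomic)
  ultimately have "pcompose ?c [:1, 1:] dvd pcompose f [:1, 1:]"
    using f by (intro irreducible_dvd_common_root[of _ "z - 1"]
        irreducible_shifted_cyclotomic[OF p]) (simp_all add: ipoly_pcompose)
  then obtain g where "pcompose f [:1, 1:] = pcompose ?c [:1, 1:] * g" by (rule dvdE)
  from arg_cong[OF this, of "\<lambda>q. pcompose q [:- 1, 1:]"]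
  have "f = ?c * pcompose g [:- 1, 1:]"
    by (simp add: pcompose_mult pcompose_assoc[symmetric] pcompose_pCons pcompose_idR)
  then show ?thesis by simp
qed

text \<open>The polynomial \<open>f\<close> whose coefficients count the exponents
  \<open>e b\<close> is divisible by the cyclotomic polynomial. This makes its coefficients periodic
  with period \<open>N\<close> below \<open>p * N\<close>, so one exponent forces all
  \<open>p\<close> exponents of its residue class modulo \<open>N\<close>. Only \<open>p\<close>
  terms are available, so each occurs exactly once.\<close>

lemma vanishing_sum_of_prime_many_roots:
  fixes z :: complex
  assumes p: "prime p" and z: "z ^ (p * p ^ k) = 1" "z ^ (p ^ k) \<noteq> 1"
    and B: "finite B" "card B = p" and e: "\<And>b. b \<in> B \<Longrightarrow> e b < p * p ^ k"
    and sum: "(\<Sum>b\<in>B. z ^ e b) = 0"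
  shows "inj_on e B" and "\<And>b b'. b \<in> B \<Longrightarrow> b' \<in> B \<Longrightarrow> e b mod p ^ k = e b' mod p ^ k"
proof -
  define N where "N = p ^ k"
  have N: "N > 0" and p1: "p > 1"
    using p prime_gt_0_nat prime_gt_1_nat[OF p] by (simp_all add: N_def)
  obtain b0 where b0: "b0 \<in> B" using B p1 by fastforce
  define f :: "int poly" where "f = (\<Sum>b\<in>B. monom 1 (e b))"
  have coeff_f: "coeff f i = int (card {b \<in> B. e b = i})" for i
    using B(1) by (simp add: f_def coeff_sum sum.inter_filter[symmetric])
  have ex: "\<exists>b\<in>B. e b = i" if "coeff f i \<noteq> 0" for i
    using that by (auto simp: coeff_f card_gt_0_iff intro: ccontr)
  have pos: "coeff f (e b) \<noteq> 0" if "b \<in> B" for b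
    using that B(1) by (auto simp: coeff_f)
  have "ipoly f z = 0" using sum by (simp add: f_def)
  then obtain g where g: "f = prime_power_cyclotomic p N * g"
    using prime_power_cyclotomic_dvd[OF p z] by (auto simp: N_def)
  have "f \<noteq> 0" using pos[OF b0] by auto
  then have g0: "g \<noteq> 0" "prime_power_cyclotomic p N \<noteq> 0" using g by auto
  have "degree f < p * N" using \<open>f \<noteq> 0\<close> by (metis N_def e ex leading_coeff_0_iff)
  moreover have "degree f = (p - 1) * N + degree g"
    using g0 p1 N by (simp add: g degree_mult_eq degree_prime_power_cyclotomic)
  ultimately have deg_g: "degree g < N"
    using p1 by (simp add: diff_mult_distrib)
  have "f * (monom 1 N - 1) = g * (monom 1 (p * N) - 1)"
    unfolding g prime_power_cyclotomic_mult[of p N, symmetric] by (simp add: algebra_simps)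
  then have eq: "monom 1 N * f - f = monom 1 (p * N) * g - g"
    by (simp add: algebra_simps)
  \<comment> \<open>At index \<open>i + N\<close> the right side of \<open>eq\<close> vanishes: the
    index is below \<open>p * N\<close> and above the degree of \<open>g\<close>.\<close>
  have step: "coeff f (i + N) = coeff f i" if "i + N < p * N" for i
    using arg_cong[OF eq, of "\<lambda>q. coeff q (i + N)"] that deg_g
    by (simp add: coeff_monom_mult coeff_eq_0)
  have period: "coeff f (r + j * N) = coeff f r" if "r < N" "j < p" for r j
    using that(2)
  proof (induction j)
    case (Suc j)
    have "r + j * N + N < p * N"
      using that(1) mult_le_mono1[of "Suc (Suc j)" p N] Suc.prems by simp
    from step[OF this] Suc show ?case by (simp add: algebra_simps)
  qed simp
  define r where "r = e b0 mod N"
  define C where "C = (\<lambda>j. r + j * N) ` {..<p}"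
  have r: "r < N" using N by (simp add: r_def)
  have "e b0 div N < p" using e[OF b0] by (simp add: N_def less_mult_imp_div_less)
  from period[OF r this] have "coeff f r \<noteq> 0"
    using pos[OF b0] by (simp add: r_def)
  then have "r + j * N \<in> e ` B" if "j < p" for j
    using ex[of "r + j * N"] period[OF r that] \<open>coeff f r \<noteq> 0\<close> by force
  then have "C \<subseteq> e ` B" by (auto simp: C_def)
  moreover have "card C = p" using N by (simp add: C_def card_image inj_on_def)
  ultimately have eB: "e ` B = C" and "card (e ` B) = p"
    using B card_image_le[of B e] card_seteq[of "e ` B" C] card_mono[of "e ` B" C] by auto
  then show "inj_on e B" using B by (intro eq_card_imp_inj_on) auto
  show "e b mod p ^ k = e b' mod p ^ k" if "b \<in> B" "b' \<in> B" for b b'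
  proof -
    have "e b \<in> C" "e b' \<in> C" using that eB by auto
    then show ?thesis by (auto simp: C_def N_def[symmetric])
  qed
qed

section \<open>Orthogonal bases of unimodular functions\<close>

text \<open>Every \<open>e s\<close> has squared norm \<open>card A\<close>, so orthogonality gives
  independence. As \<open>S\<close> has at least \<open>card A\<close> elements, each point mass
  equals its projection to the span, and point masses generate all functions on
  \<open>A\<close>.\<close>

lemma L2_orthogonal_basisI:
  assumes A: "finite A" "A \<noteq> {}" and S: "finite S" "card S \<ge> card A"
    and unit: "\<And>s x. s \<in> S \<Longrightarrow> x \<in> A \<Longrightarrow> norm (e s x) = 1"
    and orth: "\<And>s t. s \<in> S \<Longrightarrow> t \<in> S \<Longrightarrow> s \<noteq> t \<Longrightarrow> L2_inner A (e s) (e t) = 0"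
  shows "L2_orthogonal_basis A S e"
proof -
  define N :: complex where "N = of_nat (card A)"
  have N: "N \<noteq> 0" "cnj N = N" using A by (auto simp: N_def)
  have unit': "e s x * cnj (e s x) = 1" if "s \<in> S" "x \<in> A" for s x
    using unit[OF that] by (simp add: complex_norm_square[symmetric])
  have inner: "(\<Sum>x\<in>A. e s x * cnj (e t x)) = (if s = t then N else 0)"
    if "s \<in> S" "t \<in> S" for s t
    using that orth[of s t] unit' by (auto simp: L2_inner_def N_def)
  have indep: "\<forall>s\<in>S. c s = 0" if c: "\<forall>x\<in>A. (\<Sum>s\<in>S. c s * e s x) = 0" for c
  proof
    fix t assume t: "t \<in> S"
    have "0 = (\<Sum>x\<in>A. (\<Sum>s\<in>S. c s * e s x) * cnj (e t x))" using c by simp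
    also have "\<dots> = (\<Sum>x\<in>A. \<Sum>s\<in>S. c s * (e s x * cnj (e t x)))"
      by (simp add: sum_distrib_right mult.assoc)
    also have "\<dots> = (\<Sum>s\<in>S. c s * (\<Sum>x\<in>A. e s x * cnj (e t x)))"
      by (subst sum.swap) (simp add: sum_distrib_left)
    also have "\<dots> = (\<Sum>s\<in>S. if s = t then c s * N else 0)"
      using t inner by (intro sum.cong) auto
    also have "\<dots> = c t * N" using S(1) t by simp
    finally show "c t = 0" using N by simp
  qed
  text \<open>Equality in Bessel's inequality for the point mass at \<open>x\<close>: the squared distance to its
    projection is \<open>1 - |S|/|A|\<close>, which is not positive.\<close>
  have delta: "(\<Sum>s\<in>S. cnj (e s x) / N * e s y) = (if y = x then 1 else 0)"
    if x: "x \<in> A" and y: "y \<in> A" for x y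
  proof -
    define K where "K y = (\<Sum>s\<in>S. cnj (e s x) / N * e s y)" for y
    define d :: "'a \<Rightarrow> complex" where "d y = (if y = x then 1 else 0)" for y
    have "K x = (\<Sum>s\<in>S. 1 / N)"
      unfolding K_def using unit' x by (intro sum.cong) (auto simp: mult.commute)
    then have Kx: "K x = of_nat (card S) / N" by simp
    have "(\<Sum>y\<in>A. K y * cnj (K y)) =
        (\<Sum>y\<in>A. \<Sum>s\<in>S. \<Sum>t\<in>S. cnj (e s x) / N * (e t x / N) * (e s y * cnj (e t y)))"
      by (simp add: K_def sum_product N mult.assoc mult.left_commute)
    also have "\<dots> = (\<Sum>s\<in>S. \<Sum>t\<in>S. cnj (e s x) / N * (e t x / N) *
        (\<Sum>y\<in>A. e s y * cnj (e t y)))"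
      by (subst sum.swap, intro sum.cong refl, subst sum.swap) (simp add: sum_distrib_left)
    also have "\<dots> = (\<Sum>s\<in>S. \<Sum>t\<in>S. if s = t then cnj (e s x) / N * (e t x / N) * N else 0)"
      using inner by (intro sum.cong) auto
    also have "\<dots> = (\<Sum>s\<in>S. 1 / N)"
      using S(1) N unit' x by (intro sum.cong) (auto simp: mult.commute)
    finally have KK: "(\<Sum>y\<in>A. K y * cnj (K y)) = of_nat (card S) / N" by simp
    have "complex_of_real (\<Sum>y\<in>A. (norm (d y - K y))\<^sup>2)
        = (\<Sum>y\<in>A. (d y - K y) * cnj (d y - K y))"
      by (simp only: of_real_sum complex_norm_square)
    also have "\<dots> = (\<Sum>y\<in>A. (if y = x then 1 - cnj (K y) - K y else 0) + K y * cnj (K y))"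
      by (intro sum.cong) (auto simp: d_def algebra_simps)
    also have "\<dots> = 1 - cnj (K x) - K x + of_nat (card S) / N"
      using A(1) x by (simp add: sum.distrib KK)
    also have "\<dots> = complex_of_real (1 - real (card S) / real (card A))"
      by (simp add: Kx N N_def)
    finally have "(\<Sum>y\<in>A. (norm (d y - K y))\<^sup>2) = 1 - real (card S) / real (card A)"
      by (simp only: of_real_eq_iff)
    also have "\<dots> \<le> 0" using S(2) A by (simp add: card_gt_0_iff)
    finally have "(\<Sum>y\<in>A. (norm (d y - K y))\<^sup>2) = 0"
      by (rule order.antisym) (simp add: sum_nonneg)
    then have "d y = K y" using A(1) y by (simp add: sum_nonneg_eq_0_iff)
    then show ?thesis by (simp add: K_def d_def)
  qed
  have span: "\<exists>c. \<forall>y\<in>A. f y = (\<Sum>s\<in>S. c s * e s y)" for f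
  proof (intro exI ballI)
    fix y assume y: "y \<in> A"
    have "f y = (\<Sum>x\<in>A. f x * (if y = x then 1 else 0))"
      using A(1) y by (simp add: if_distrib[of "\<lambda>c. _ * c"] cong: if_cong)
    also have "\<dots> = (\<Sum>x\<in>A. f x * (\<Sum>s\<in>S. cnj (e s x) / N * e s y))"
      using delta y by (intro sum.cong) auto
    also have "\<dots> = (\<Sum>s\<in>S. (\<Sum>x\<in>A. f x * cnj (e s x) / N) * e s y)"
      by (simp add: sum_distrib_left sum_distrib_right mult.assoc) (subst sum.swap, simp)
    finally show "f y = (\<Sum>s\<in>S. (\<Sum>x\<in>A. f x * cnj (e s x) / N) * e s y)" .
  qed
  show ?thesis
    unfolding L2_orthogonal_basis_def L2_basis_def using S(1) indep span orth by blast
qed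

section \<open>Characters and Fourier transforms\<close>

definition unity :: "nat \<Rightarrow> int \<Rightarrow> complex" where
  "unity n k = cis (2 * pi * of_int k / of_nat n)"

lemma unity_0 [simp]: "unity n 0 = 1"
  by (simp add: unity_def)

lemma unity_add: "unity n (j + k) = unity n j * unity n k"
  by (simp add: unity_def cis_mult add_divide_distrib distrib_left)

lemma unity_diff: "unity n (j - k) = unity n j * cnj (unity n k)"
  by (simp add: unity_def cis_cnj cis_mult diff_divide_distrib right_diff_distrib)

lemma unity_power: "unity n k ^ i = unity n (int i * k)"
  by (induction i) (simp_all add: unity_add distrib_right)

lemma norm_unity [simp]: "norm (unity n k) = 1"
  by (simp add: unity_def)

lemma unity_eq_1_iff:
  assumes "n > 0"
  shows "unity n k = 1 \<longleftrightarrow> int n dvd k"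
proof
  assume "unity n k = 1"
  then have "cos (2 * pi * of_int k / of_nat n) = 1"
    by (simp add: unity_def complex_eq_iff)
  then obtain j :: int where "2 * pi * of_int k / of_nat n = of_int j * 2 * pi"
    using cos_one_2pi_int by blast
  then have "of_int k = (of_int (j * int n) :: real)"
    using assms by (simp add: field_simps)
  then have "k = j * int n" by (simp only: of_int_eq_iff)
  then show "int n dvd k" by simp
next
  assume "int n dvd k"
  then obtain j where "k = int n * j" by (rule dvdE)
  then have "2 * pi * of_int k / of_nat n = 2 * pi * of_int j" using assms by simp
  then show "unity n k = 1" using cis_multiple_2pi[of "of_int j"] by (simp add: unity_def)
qed

lemma unity_cong:
  assumes "n > 0" "int n dvd j - k"
  shows "unity n j = unity n k"
  using unity_add[of n "j - k" k] unity_eq_1_iff[OF assms(1), of "j - k"] assms(2) by simp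

text \<open>The pairing before reduction modulo \<open>n\<close>: it is bilinear over the integers,
  and \<open>unity_cong\<close> absorbs the reduction.\<close>

definition dot :: "int \<times> int \<Rightarrow> int \<times> int \<Rightarrow> int" where
  "dot x y = fst x * fst y + snd x * snd y"

lemma dot_commute: "dot x y = dot y x"
  by (simp add: dot_def mult.commute)

lemma dot_diff_left: "dot (x - y) z = dot x z - dot y z"
  and dot_diff_right: "dot z (x - y) = dot z x - dot z y"
  and dot_add_left: "dot (x + y) z = dot x z + dot y z"
  and dot_add_right: "dot z (x + y) = dot z x + dot z y"
  by (simp_all add: dot_def algebra_simps)

lemma character_eq_unity:
  assumes "n > 0"
  shows "character n s x = unity n (dot x s)"
proof -
  have "character n s x = unity n (pairing n x s)"
    by (simp add: character_def unity_def cis_conv_exp mult_ac)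
  also have "\<dots> = unity n (dot x s)"
    using assms by (intro unity_cong) (simp_all add: pairing_def dot_def mod_eq_dvd_iff[symmetric])
  finally show ?thesis .
qed

text \<open>The Fourier transform of the indicator function of \<open>A\<close>, with positive sign
  in the exponent. Frequencies are arbitrary integer pairs, so differences of them need no
  reduction.\<close>

definition hat :: "nat \<Rightarrow> (int \<times> int) set \<Rightarrow> int \<times> int \<Rightarrow> complex" where
  "hat n A u = (\<Sum>x\<in>A. unity n (dot x u))"

lemma L2_inner_character:
  assumes "n > 0"
  shows "L2_inner A (character n s) (character n t) = hat n A (s - t)"
  by (simp add: L2_inner_def hat_def character_eq_unity[OF assms] dot_diff_right unity_diff)

lemma sum_unity_multiples:
  assumes "n > 0"
  shows "(\<Sum>x\<in>{0..<int n}. unity n (x * a)) = (if int n dvd a then of_nat n else 0)"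
proof -
  have "(\<Sum>x\<in>{0..<int n}. unity n (x * a)) = (\<Sum>i<n. unity n a ^ i)"
    by (rule sum.reindex_bij_witness[of _ int nat]) (auto simp: unity_power)
  also have "\<dots> = (if int n dvd a then of_nat n else 0)"
  proof (cases "int n dvd a")
    case True
    then show ?thesis using unity_eq_1_iff[OF assms, of a] by simp
  next
    case False
    then have "unity n a \<noteq> 1" using unity_eq_1_iff[OF assms] by simp
    moreover have "unity n a ^ n = 1"
      using unity_eq_1_iff[OF assms, of "int n * a"] by (simp add: unity_power)
    ultimately show ?thesis using False by (simp add: geometric_sum)
  qed
  finally show ?thesis .
qed

section \<open>Representatives modulo n and the transform of the whole group\<close>

definition box :: "nat \<Rightarrow> (int \<times> int) set" where
  "box n = {0..<int n} \<times> {0..<int n}"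

lemma card_box: "card (box n) = n ^ 2" and finite_box [simp]: "finite (box n)"
  by (simp_all add: box_def power2_eq_square)

lemma carrier_ZnZn: "n > 0 \<Longrightarrow> carrier (ZnZn n) = box n"
  by (simp add: box_def carrier_integer_mod_group)

text \<open>Being zero in the group, for integer pairs that need not be reduced to
  \<open>box n\<close>.\<close>

definition null_mod :: "nat \<Rightarrow> int \<times> int \<Rightarrow> bool" where
  "null_mod n u \<longleftrightarrow> int n dvd fst u \<and> int n dvd snd u"

lemma null_mod_0 [simp]: "null_mod n 0"
  by (simp add: null_mod_def)

lemma null_mod_dot: "null_mod n u \<Longrightarrow> int n dvd dot x u"
  by (simp add: null_mod_def dot_def)

lemma box_eq_iff:
  assumes "x \<in> box n" "y \<in> box n"
  shows "null_mod n (x - y) \<longleftrightarrow> x = y"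
proof
  assume "null_mod n (x - y)"
  then have "fst x mod int n = fst y mod int n" "snd x mod int n = snd y mod int n"
    by (simp_all add: null_mod_def mod_eq_dvd_iff)
  then show "x = y" using assms by (auto simp: box_def)
qed (simp add: null_mod_def)

lemma hat_box:
  assumes "n > 0"
  shows "hat n (box n) u = (if null_mod n u then of_nat (n ^ 2) else 0)"
proof -
  have "hat n (box n) u = (\<Sum>x\<in>{0..<int n}. unity n (x * fst u)) *
      (\<Sum>x\<in>{0..<int n}. unity n (x * snd u))"
    by (simp add: hat_def box_def dot_def unity_add sum_product sum.cartesian_product case_prod_beta)
  then show ?thesis
    by (simp add: sum_unity_multiples[OF assms] null_mod_def power2_eq_square)
qed

text \<open>Unique decomposition makes addition a bijection from \<open>A \<times> B\<close> onto
  the group. Counting gives the cardinalities; characters are multiplicative, so their sum over the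
  group factors.\<close>

lemma tile_complement:
  assumes n: "n > 0" and A: "tile (ZnZn n) A"
  obtains B where "B \<subseteq> box n" "card A * card B = n ^ 2"
    "\<And>u. hat n A u * hat n B u = hat n (box n) u"
proof -
  define add where "add ab = fst ab \<otimes>\<^bsub>ZnZn n\<^esub> snd ab" for ab
  have "\<exists>B. B \<subseteq> box n \<and> (\<forall>g\<in>box n. \<exists>!ab. ab \<in> A \<times> B \<and> g = add ab)"
    using A unfolding tile_def carrier_ZnZn[OF n] add_def[symmetric] by (rule conjunct2)
  then obtain B where B: "B \<subseteq> box n"
    and uniq: "\<And>g. g \<in> box n \<Longrightarrow> \<exists>!ab. ab \<in> A \<times> B \<and> g = add ab"
    by metis
  have add: "add ab = ((fst (fst ab) + fst (snd ab)) mod int n,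
      (snd (fst ab) + snd (snd ab)) mod int n)" for ab
    by (simp add: add_def DirProd_def case_prod_beta)
  have in_box: "add ab \<in> box n" for ab using n by (simp add: add box_def)
  have bij: "bij_betw add (A \<times> B) (box n)"
  proof (rule bij_betwI')
    show "add ab = add cd \<longleftrightarrow> ab = cd" if "ab \<in> A \<times> B" "cd \<in> A \<times> B" for ab cd
      using uniq[OF in_box[of ab]] that by metis
    show "\<exists>ab\<in>A \<times> B. g = add ab" if "g \<in> box n" for g
      using uniq[OF that] by blast
  qed (rule in_box)
  have "card A * card B = n ^ 2"
    using bij_betw_same_card[OF bij] by (simp add: card_cartesian_product card_box)
  moreover have "hat n A u * hat n B u = hat n (box n) u" for u
  proof -
    have "int n dvd dot (add ab) u - dot (fst ab + snd ab) u" for ab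
    proof -
      have "null_mod n (add ab - (fst ab + snd ab))"
        by (simp add: null_mod_def add mod_eq_dvd_iff[symmetric])
      from null_mod_dot[OF this, of u] show ?thesis
        by (simp add: dot_commute[of u] dot_diff_left)
    qed
    then have eq: "unity n (dot (add ab) u) = unity n (dot (fst ab) u) * unity n (dot (snd ab) u)" for ab
      by (metis dot_add_left n unity_add unity_cong)
    have "hat n (box n) u = (\<Sum>ab\<in>A \<times> B. unity n (dot (add ab) u))"
      unfolding hat_def by (rule sum.reindex_bij_betw[OF bij, symmetric])
    also have "\<dots> = hat n A u * hat n B u"
      by (simp add: eq hat_def sum_product sum.cartesian_product case_prod_beta)
    finally show ?thesis by simp
  qed
  ultimately show thesis using B that by blast
qed

text \<open>Fourier inversion at a point \<open>x\<close> of \<open>A\<close>: if only the zero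
  frequency contributed, the inversion sum would be \<open>card A\<close>, whereas it is always
  \<open>n ^ 2\<close>.\<close>

lemma ex_nontrivial_hat_neq_0:
  assumes n: "n > 0" and A: "A \<subseteq> box n" "A \<noteq> {}" "card A \<noteq> n ^ 2"
  shows "\<exists>u. \<not> null_mod n u \<and> hat n A u \<noteq> 0"
proof (rule ccontr)
  assume "\<nexists>u. \<not> null_mod n u \<and> hat n A u \<noteq> 0"
  then have zero: "hat n A u = 0" if "\<not> null_mod n u" for u  using that by blast
  obtain x where x: "x \<in> A" using A by blast
  have fin: "finite A" by (rule finite_subset[OF A(1) finite_box])
  have z: "(0, 0) \<in> box n" using n by (simp add: box_def)
  have "(\<Sum>s\<in>box n. hat n A s * cnj (unity n (dot x s)))
      = (\<Sum>s\<in>box n. if s = (0, 0) then of_nat (card A) else 0)"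
  proof (intro sum.cong refl)
    fix s assume "s \<in> box n"
    then have "s = (0, 0) \<longleftrightarrow> null_mod n s"
      using box_eq_iff[of s n "(0, 0)"] z by (simp add: zero_prod_def[symmetric])
    moreover have "hat n A (0, 0) = of_nat (card A)" by (simp add: hat_def dot_def)
    ultimately show "hat n A s * cnj (unity n (dot x s)) = (if s = (0, 0) then of_nat (card A) else 0)"
      using zero by (auto simp: dot_def)
  qed
  also have "\<dots> = of_nat (card A)" using z by simp
  finally have 1: "(\<Sum>s\<in>box n. hat n A s * cnj (unity n (dot x s))) = of_nat (card A)" .
  \<comment> \<open>Exchanging the sums leaves the transform of the whole group at
    \<open>a - x\<close>, which survives only for \<open>a = x\<close>.\<close>
  have "(\<Sum>s\<in>box n. hat n A s * cnj (unity n (dot x s))) = (\<Sum>a\<in>A. hat n (box n) (a - x))"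
    unfolding hat_def sum_distrib_right
    by (subst sum.swap) (simp add: unity_diff[symmetric] dot_diff_right dot_commute)
  also have "\<dots> = (\<Sum>a\<in>A. if a = x then of_nat (n ^ 2) else 0)"
    using A(1) x box_eq_iff[of _ n x] by (intro sum.cong) (auto simp: hat_box[OF n])
  also have "\<dots> = of_nat (n ^ 2)" using x fin by simp
  finally show False using 1 A(3) by (simp only: of_nat_eq_iff)
qed

section \<open>The spectrum of a tile\<close>

text \<open>The transform at \<open>u\<close> is a sum of \<open>p\<close> powers of a primitive
  root of unity of order \<open>p ^ Suc k\<close>. Since it vanishes, the exponents \<open>e\<close>
  agree modulo \<open>p ^ k\<close> and are pairwise distinct below
  \<open>p ^ Suc k\<close>.\<close>

lemma hat_eq_0_prime_card:
  assumes p: "prime p" and B: "finite B" "card B = p" and u: "hat (p ^ Suc k) B u = 0"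
    and b: "b \<in> B" "b' \<in> B"
  shows "int (p ^ k) dvd dot (b - b') u"
    and "b \<noteq> b' \<Longrightarrow> \<not> int (p ^ Suc k) dvd dot (b - b') u"
proof -
  define n where "n = p ^ Suc k"
  define N where "N = p ^ k"
  have n: "n > 0" "n = p * N" and N: "N > 0"
    using p by (simp_all add: n_def N_def prime_gt_0_nat)
  define z where "z = unity n 1"
  define e where "e x = nat (dot x u mod int n)" for x
  have int_e: "int (e x) = dot x u mod int n" for x using n(1) by (simp add: e_def)
  have z1: "z ^ (p * p ^ k) = 1"
    using unity_eq_1_iff[OF n(1)] n(2) by (simp add: z_def unity_power N_def)
  have "\<not> n dvd N"
    using n(2) N prime_gt_1_nat[OF p] by (auto dest: dvd_imp_le)
  then have z2: "z ^ (p ^ k) \<noteq> 1"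
    using unity_eq_1_iff[OF n(1), of "int N"] by (simp add: z_def unity_power N_def[symmetric])
  have e_less: "e x < p * p ^ k" for x
  proof -
    have "int (e x) < int n" unfolding int_e using n(1) by simp
    then show ?thesis using n(2) by (simp only: of_nat_less_iff N_def)
  qed
  have "z ^ e x = unity n (dot x u)" for x
  proof -
    have "z ^ e x = unity n (int (e x))" by (simp add: z_def unity_power)
    also have "\<dots> = unity n (dot x u)"
      using n(1) by (intro unity_cong) (simp_all add: int_e mod_eq_dvd_iff[symmetric])
    finally show ?thesis .
  qed
  then have "(\<Sum>x\<in>B. z ^ e x) = 0" using u by (simp add: hat_def n_def)
  note roots = vanishing_sum_of_prime_many_roots[OF p z1 z2 B e_less this]
  have "int N dvd int n" using n(2) by simp
  then have "int (e x) mod int N = dot x u mod int N" for x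
    by (simp add: int_e mod_mod_cancel)
  then have "dot b u mod int N = dot b' u mod int N"
    using roots(2)[OF b] by (metis N_def zmod_int)
  then show "int (p ^ k) dvd dot (b - b') u"
    by (simp add: mod_eq_dvd_iff N_def dot_diff_left)
  show "\<not> int (p ^ Suc k) dvd dot (b - b') u" if "b \<noteq> b'"
  proof
    assume "int (p ^ Suc k) dvd dot (b - b') u"
    then have "dot b u mod int n = dot b' u mod int n"
      by (simp add: mod_eq_dvd_iff n_def dot_diff_left)
    then have "e b = e b'" by (simp add: e_def)
    then show False using inj_onD[OF roots(1)] b that by blast
  qed
qed

theorem lemma13:
  fixes p m :: nat and A :: "(int \<times> int) set"
  assumes "prime p" and "m > 0"
    and "tile (ZnZn (p ^ m)) A"
    and "card A = p ^ (2 * m - 1)"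
  shows "spectral (p ^ m) A"
proof -
  note p = assms(1)
  have p1: "p > 1" by (rule prime_gt_1_nat[OF p])
  obtain k where m: "m = Suc k" using assms(2) gr0_implies_Suc by blast
  define n where "n = p ^ Suc k"
  define N where "N = p ^ k"
  have n: "n > 0" "n = p * N" and N: "N > 0"
    using p1 by (simp_all add: n_def N_def)
  have n_sq: "n ^ 2 = p ^ (2 * m - 1) * p"
    by (simp add: n_def m power2_eq_square power_add mult_2)
  have A_box: "A \<subseteq> box n" using assms(3) carrier_ZnZn[OF n(1)] by (simp add: tile_def n_def m)
  have A_ne: "A \<noteq> {}" using assms(4) p1 by auto
  have A_card: "card A \<noteq> n ^ 2" using assms(4) p1 by (simp add: n_sq)
  obtain B where B: "B \<subseteq> box n" "card A * card B = n ^ 2"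
    and hats: "\<And>u. hat n A u * hat n B u = hat n (box n) u"
    using tile_complement[OF n(1)] assms(3) by (metis m n_def)
  have fin_B: "finite B" by (rule finite_subset[OF B(1) finite_box])
  have card_B: "card B = p" using B(2) assms(4) p1 by (simp add: n_sq)
  have zero: "hat n A u = 0 \<or> hat n B u = 0" if "\<not> null_mod n u" for u
    using hats[of u] that by (simp add: hat_box[OF n(1)])
  \<comment> \<open>A nonzero frequency at which the transform of \<open>A\<close> survives must be
    a zero of the transform of \<open>B\<close>. This zero later gives the direction in which
    translates of \<open>S\<close> cover the group.\<close>
  obtain s0 where "hat n B s0 = 0"
    using ex_nontrivial_hat_neq_0[OF n(1) A_box A_ne A_card] zero by blast
  note s0 = hat_eq_0_prime_card[OF p fin_B card_B this[unfolded n_def], folded n_def N_def]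
  obtain b1 b2 where b: "b1 \<in> B" "b2 \<in> B" "b1 \<noteq> b2"
    using card_B p1 by (metis card_le_Suc0_iff_eq fin_B One_nat_def not_le)
  define d where "d = b1 - b2"
  define T where "T = {u. \<forall>b\<in>B. \<forall>b'\<in>B. int N dvd dot (b - b') u}"
  have T_diff: "u - v \<in> T" if "u \<in> T" "v \<in> T" for u v
    using that by (auto simp: T_def dot_diff_right)
  have T_add: "u + v \<in> T" if "u \<in> T" "v \<in> T" for u v
    using that by (auto simp: T_def dot_add_right)
  have T_0: "0 \<in> T" by (simp add: T_def dot_def)
  \<comment> \<open>The chosen element depends only on the coset of \<open>x\<close> modulo
    \<open>T\<close>, so \<open>rep\<close> is constant on cosets.\<close>
  define rep where "rep x = (SOME y. x - y \<in> T)" for x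
  have rep: "x - rep x \<in> T" for x
    unfolding rep_def by (rule someI[of _ x]) (simp add: T_0)
  have rep_cong: "rep x = rep y" if "x - y \<in> T" for x y
  proof -
    have "x - z \<in> T \<longleftrightarrow> y - z \<in> T" for z
      using T_diff[of "x - z" "x - y"] T_add[of "x - y" "y - z"] that by auto
    then show ?thesis by (simp add: rep_def)
  qed
  \<comment> \<open>This is \<open>R + L\<close> cut down to \<open>box n\<close>, with
    \<open>R\<close> the range of \<open>rep\<close>: \<open>x - rep x\<close> always lies in
    \<open>T\<close>, so membership in \<open>L\<close> reduces to orthogonality to
    \<open>d\<close>.\<close>
  define S where "S = {x \<in> box n. int n dvd dot d (x - rep x)}"
  have S_box: "S \<subseteq> box n" by (auto simp: S_def)
  have fin_S: "finite S" by (rule finite_subset[OF S_box finite_box])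

  have orth: "hat n A (s - t) = 0" if s: "s \<in> S" and t: "t \<in> S" and "s \<noteq> t" for s t
  proof (rule ccontr)
    assume "hat n A (s - t) \<noteq> 0"
    moreover have "\<not> null_mod n (s - t)"
      using s t \<open>s \<noteq> t\<close> by (simp add: S_def box_eq_iff)
    ultimately have "hat n B (s - t) = 0" using zero by blast
    note st = hat_eq_0_prime_card[OF p fin_B card_B this[unfolded n_def], folded n_def N_def]
    \<comment> \<open>A zero \<open>s - t\<close> lies in \<open>T\<close>, so \<open>s\<close> and
      \<open>t\<close> share their representative and \<open>s - t\<close> is orthogonal to
      \<open>d\<close> modulo \<open>n\<close>. That would make \<open>b1\<close> and
      \<open>b2\<close> agree at \<open>s - t\<close>.\<close>
    have "rep s = rep t" using st(1) by (intro rep_cong) (simp add: T_def)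
    then have "dot d (s - t) = dot d (s - rep s) - dot d (t - rep t)"
      by (simp add: dot_diff_right)
    then have "int n dvd dot d (s - t)" using s t by (simp add: S_def)
    then show False using st(2)[OF b] by (simp add: d_def)
  qed

  have "card A \<le> card S"
  proof -
    \<comment> \<open>The translates of \<open>S\<close> by \<open>j\<close> times
      \<open>s0\<close>, for \<open>j\<close> below \<open>p\<close>, cover the group. Hence
      \<open>n ^ 2\<close> is at most \<open>card S * p\<close>, and cancelling \<open>p\<close>
      leaves \<open>card A\<close>.\<close>
    define shift where "shift = (\<lambda>(s, j). ((fst s + j * fst s0) mod int n,
      (snd s + j * snd s0) mod int n))"
    have "box n \<subseteq> shift ` (S \<times> {0..<int p})"
    proof
      fix g assume g: "g \<in> box n"
      obtain a where a: "dot d (g - rep g) = int N * a"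
        using rep[of g] b unfolding T_def d_def by (blast elim: dvdE)
      obtain v where v: "dot d s0 = int N * v"
        using s0(1)[OF b(1,2)] unfolding d_def by (blast elim: dvdE)
      \<comment> \<open>\<open>s0\<close> separates \<open>b1\<close> from \<open>b2\<close> modulo
        \<open>n\<close>, so its pairing with \<open>d\<close> is a multiple of \<open>N\<close> but
        not of \<open>n\<close>. Thus \<open>v\<close> is invertible modulo
        \<open>p\<close>.\<close>
      have "\<not> int p dvd v"
      proof
        assume "int p dvd v"
        then have "int n dvd dot d s0" by (simp add: v n(2) mult.commute mult_dvd_mono)
        then show False using s0(2)[OF b] by (simp add: d_def)
      qed
      then have "coprime v (int p)"
        using p prime_imp_coprime[of "int p" v] by (simp add: coprime_commute)
      then obtain w where w: "[v * w = 1] (mod int p)"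
        using cong_solve_coprime_int by blast
      \<comment> \<open>This solves \<open>j * v = a\<close> modulo \<open>p\<close>: subtracting
        \<open>j\<close> times \<open>s0\<close> cancels the pairing of \<open>g - rep g\<close>
        with \<open>d\<close> modulo \<open>n\<close>.\<close>
      define j where "j = (a * w) mod int p"
      have j: "j \<in> {0..<int p}" using p1 by (simp add: j_def)
      have "[j * v = a] (mod int p)"
      proof -
        have "[j * v = (a * w) * v] (mod int p)"
          unfolding j_def by (intro cong_scalar_right) simp
        also have "(a * w) * v = a * (v * w)" by simp
        also have "[a * (v * w) = a * 1] (mod int p)" using w by (rule cong_scalar_left)
        finally show ?thesis by simp
      qed
      then have "int p dvd a - j * v" by (simp add: cong_iff_dvd_diff dvd_diff_commute)
      then have dvd: "int n dvd int N * a - j * (int N * v)"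
        by (metis mult.commute mult.left_commute mult_dvd_mono dvd_refl n(2) of_nat_mult
            right_diff_distrib)
      define js where "js = (j * fst s0, j * snd s0)"
      define x where "x = (fst (g - js) mod int n, snd (g - js) mod int n)"
      have x_box: "x \<in> box n" using n(1) by (simp add: x_def box_def)
      \<comment> \<open>\<open>q\<close> is the effect of reducing \<open>g - js\<close> to
        \<open>box n\<close>. It lies in \<open>T\<close>, as does \<open>js\<close>, so passing
        from \<open>g\<close> to \<open>x\<close> keeps the representative, and modulo
        \<open>n\<close> its pairing with \<open>d\<close> is zero.\<close>
      define q where "q = x - (g - js)"
      have q: "null_mod n q"
        by (simp add: q_def x_def null_mod_def mod_eq_dvd_iff[symmetric])
      have "int N dvd dot y q" for y
        using null_mod_dot[OF q, of y] n(2) by (metis dvd_mult_right of_nat_mult)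
      moreover have dot_js: "dot y js = j * dot y s0" for y
        by (simp add: js_def dot_def algebra_simps)
      ultimately have "q - js \<in> T" using s0(1) by (simp add: T_def dot_diff_right)
      then have "rep x = rep g" by (intro rep_cong) (simp add: q_def algebra_simps)
      then have "x - rep x = (g - rep g) - js + q" by (simp add: q_def algebra_simps)
      then have "dot d (x - rep x) = int N * a - j * (int N * v) + dot d q"
        using a by (simp add: dot_diff_right dot_add_right dot_js v)
      then have "int n dvd dot d (x - rep x)"
        using dvd_add[OF dvd null_mod_dot[OF q, of d]] by (simp only:)
      then have "x \<in> S" using x_box unfolding S_def by blast
      moreover have "shift (x, j) = g"
        using g by (cases g) (simp add: shift_def x_def js_def box_def mod_simps)
      ultimately show "g \<in> shift ` (S \<times> {0..<int p})" using j by force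
    qed
    then have "n ^ 2 \<le> card S * p"
      using card_mono[of "shift ` (S \<times> {0..<int p})" "box n"] fin_S
        card_image_le[of "S \<times> {0..<int p}" shift]
      by (simp add: card_box card_cartesian_product)
    then show ?thesis using p1 by (simp add: n_sq assms(4))
  qed
  then have "L2_orthogonal_basis A S (character n)"
    using A_box A_ne fin_S orth finite_subset[OF A_box finite_box]
    by (intro L2_orthogonal_basisI)
      (simp_all add: L2_inner_character[OF n(1)] character_eq_unity[OF n(1)])
  then show ?thesis
    using A_box S_box carrier_ZnZn[OF n(1)] unfolding spectral_def m n_def by auto
qed

end
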